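(* Let $r$ be a prime number and $m$ a positive integer with $2\mid (r^m-1)$, and let $q$ be a power of an odd prime $p$ with $\gcd(p,r)=1$. Take $N=2$, let $\varphi:\mathbb{F}_{r^m}^*\to\mathbb{F}_q^*$ be the homomorphism of order $2$ defined in the context, let $P$ be the $r^m\times r^m$ matrix over $\mathbb{F}_q$ defined in the context with diagonal value $v=0$, and let $C=C_{(\varphi,0)}$ be the linear code over $\mathbb{F}_q$ with generator matrix $[I_{r^m},P]$. Let $\mu_{x_1},\dots,\mu_{x_{r^m}}$ and $\nu_{x_1},\dots,\nu_{x_{r^m}}$ be the row vectors defined in the context. Let $A$ be a positive integer. Assume that any $A$ vectors in $\{\mu_{x_1},\dots,\mu_{x_{r^m}}\}$ are linearly independent and any $A$ vectors in $\{\nu_{x_1},\dots,\nu_{x_{r^m}}\}$ are linearly independent. Then the minimum Hamming distance of $C$ satisfies $d_{\min}(C)\ge A+1$.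
   Context: Fix a primitive element $\alpha$ of $\mathbb{F}_{r^m}$ and define $\varphi:\mathbb{F}_{r^m}^*\to\mathbb{F}_q^*$ by $\varphi(\alpha^k)=(-1)^k$ for $0\le k\le r^m-2$ (so $\varphi(x)=1$ if $x$ is a nonzero square and $\varphi(x)=-1$ otherwise). Enumerate $\mathbb{F}_{r^m}=\{x_i:1\le i\le r^m\}$ so that $x_1,\dots,x_{(r^m-1)/2}$ are the nonzero squares, $x_{(r^m+1)/2},\dots,x_{r^m-1}$ are the non-squares, and $x_{r^m}=0$. $P=(p_{ij})$ is the $r^m\times r^m$ matrix over $\mathbb{F}_q$ with $p_{ij}=\varphi(x_j-x_i)$ for $i\ne j$ and $p_{ii}=v=0$. $C_{(\varphi,0)}$ is the linear code over $\mathbb{F}_q$ generated by the rows of $[I_{r^m},P]$. Let $t$ be a positive integer with $r\mid (q^t-1)$, let $\gamma$ be a fixed primitive element of $\mathbb{F}_{q^t}$ and $\zeta=\gamma^{(q^t-1)/r}$. For $a\in\mathbb{F}_{r^m}$ define $\chi_a:\mathbb{F}_{r^m}\to\overline{\mathbb{F}}_q^*$ by $\chi_a(x)=\zeta^{\mathrm{Tr}(ax)}$, where $\mathrm{Tr}$ is the trace from $\mathbb{F}_{r^m}$ to $\mathbb{F}_r$, and let $\eta_a=(\chi_a(x_1),\dots,\chi_a(x_{r^m}))^T$. $\mu_{x_1},\dots,\mu_{x_{r^m}}$ are the successive rows of the $r^m\times\frac{r^m-1}{2}$ matrix with columns $\eta_{x_1},\dots,\eta_{x_{(r^m-1)/2}}$,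 and $\nu_{x_1},\dots,\nu_{x_{r^m}}$ are the successive rows of the $r^m\times\frac{r^m-1}{2}$ matrix with columns $\eta_{x_{(r^m+1)/2}},\dots,\eta_{x_{r^m-1}}$. "Any $A$ vectors" means the vectors with any $A$ distinct indices, and linear independence is over $\overline{\mathbb{F}}_q$.
   Formalization: The formal theorem also assumes A ≤ r^m, so that A distinct vectors can be chosen; for A > r^m the independence assumptions would be vacuous and the bound d_min(C) ≥ A+1 false by the Singleton bound. *)

theory Defs
  imports
    "HOL-Algebra.Algebraic_Closure_Type"
    "HOL-Library.Cardinality"
    "Jordan_Normal_Form.VS_Connect"
begin

text \<open>Throughout, a finite field of given order is a type of class \<^class>\<open>finite_field\<close> with that
  cardinality, and \<open>n\<close> stands for the number \<open>r ^ m\<close> of elements of the field of the \<open>x\<^sub>i\<close>. Its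
  elements are enumerated as \<open>x 1, \<dots>, x n\<close>, whereas vectors and matrices are indexed from \<open>0\<close>;
  hence the shifts by one below.\<close>

definition primitive_element :: "'a::field set \<Rightarrow> 'a \<Rightarrow> bool" where
  "primitive_element F a \<longleftrightarrow> a \<in> F \<and> {a ^ k |k. True} = F - {0}"

text \<open>Only meaningful at nonzero arguments.\<close>

definition phi :: "'f::finite_field \<Rightarrow> 'f \<Rightarrow> 'q::finite_field" where
  "phi \<alpha> y = (-1) ^ (THE k. k \<le> CARD('f) - 2 \<and> \<alpha> ^ k = y)"

definition square_enumeration :: "nat \<Rightarrow> (nat \<Rightarrow> 'f::finite_field) \<Rightarrow> bool" where
  "square_enumeration n x \<longleftrightarrow>
     bij_betw x {1..n} UNIV \<and>
     x ` {1..(n - 1) div 2} = {y. y \<noteq> 0 \<and> (\<exists>z. y = z ^ 2)} \<and>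
     x ` {(n + 1) div 2..n - 1} = {y. \<not> (\<exists>z. y = z ^ 2)} \<and>
     x n = 0"

definition P_mat :: "nat \<Rightarrow> (nat \<Rightarrow> 'f::finite_field) \<Rightarrow> ('f \<Rightarrow> 'q::finite_field) \<Rightarrow> 'q \<Rightarrow> 'q mat" where
  "P_mat n x \<phi> v =
     mat n n (\<lambda>(i, j). if i = j then v else \<phi> (x (Suc j) - x (Suc i)))"

definition generator_mat :: "nat \<Rightarrow> (nat \<Rightarrow> 'f::finite_field) \<Rightarrow> ('f \<Rightarrow> 'q::finite_field) \<Rightarrow> 'q \<Rightarrow> 'q mat" where
  "generator_mat n x \<phi> v =
     four_block_mat (1\<^sub>m n) (P_mat n x \<phi> v) (0\<^sub>m 0 n) (0\<^sub>m 0 n)"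

definition code :: "nat \<Rightarrow> (nat \<Rightarrow> 'f::finite_field) \<Rightarrow> ('f \<Rightarrow> 'q::finite_field) \<Rightarrow> 'q \<Rightarrow> 'q vec set" where
  "code n x \<phi> v = vec_space.row_space (2 * n) (generator_mat n x \<phi> v)"

definition hamming_dist :: "'q vec \<Rightarrow> 'q vec \<Rightarrow> nat" where
  "hamming_dist u w = card {i. i < dim_vec u \<and> u $ i \<noteq> w $ i}"

definition min_dist :: "'q vec set \<Rightarrow> nat" where
  "min_dist C = Inf {hamming_dist u w |u w. u \<in> C \<and> w \<in> C \<and> u \<noteq> w}"

text \<open>The trace from the field with \<open>r ^ m\<close> elements to its prime field with \<open>r\<close> elements, and the
  residue in \<open>{0..<r}\<close> that represents it when it is used as an exponent of an \<open>r\<close>-th root of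
  unity.\<close>

definition field_trace :: "nat \<Rightarrow> nat \<Rightarrow> 'f::finite_field \<Rightarrow> 'f" where
  "field_trace r m y = (\<Sum>i<m. y ^ (r ^ i))"

definition trace_nat :: "nat \<Rightarrow> nat \<Rightarrow> 'f::finite_field \<Rightarrow> nat" where
  "trace_nat r m y = (THE k. k < r \<and> of_nat k = field_trace r m y)"

definition chi :: "nat \<Rightarrow> nat \<Rightarrow> 'k::field \<Rightarrow> 'f::finite_field \<Rightarrow> 'f \<Rightarrow> 'k" where
  "chi r m \<zeta> a y = \<zeta> ^ trace_nat r m (a * y)"

definition eta :: "nat \<Rightarrow> nat \<Rightarrow> 'k::field \<Rightarrow> (nat \<Rightarrow> 'f::finite_field) \<Rightarrow> 'f \<Rightarrow> 'k vec" where
  "eta r m \<zeta> x a = vec (r ^ m) (\<lambda>i. chi r m \<zeta> a (x (Suc i)))"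

definition mu :: "nat \<Rightarrow> nat \<Rightarrow> 'k::field \<Rightarrow> (nat \<Rightarrow> 'f::finite_field) \<Rightarrow> nat \<Rightarrow> 'k vec" where
  "mu r m \<zeta> x i =
     row (mat_of_cols (r ^ m)
       (map (\<lambda>j. eta r m \<zeta> x (x j)) [1..<(r ^ m - 1) div 2 + 1])) (i - 1)"

definition nu :: "nat \<Rightarrow> nat \<Rightarrow> 'k::field \<Rightarrow> (nat \<Rightarrow> 'f::finite_field) \<Rightarrow> nat \<Rightarrow> 'k vec" where
  "nu r m \<zeta> x i =
     row (mat_of_cols (r ^ m)
       (map (\<lambda>j. eta r m \<zeta> x (x j)) [(r ^ m + 1) div 2..<r ^ m])) (i - 1)"

text \<open>Any \<open>A\<close> of the vectors \<open>w 1, \<dots>, w n\<close> of dimension \<open>d\<close>, chosen by their indices, are linearly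
  independent. As \<open>lin_indpt\<close> is a property of sets, injectivity has to be required separately: a
  family with a repeated vector is dependent.\<close>

definition any_indpt :: "nat \<Rightarrow> nat \<Rightarrow> nat \<Rightarrow> (nat \<Rightarrow> 'k::field vec) \<Rightarrow> bool" where
  "any_indpt d n A w \<longleftrightarrow>
     (\<forall>S \<subseteq> {1..n}. card S = A \<longrightarrow>
        inj_on w S \<and> LinearCombinations.module.lin_indpt class_ring (module_vec TYPE('k) d) (w ` S))"

end

theory Submission
  imports Defs "HOL-Number_Theory.Residues"
begin

text \<open>Let \<open>c = (u, u P)\<close> be a nonzero codeword and \<open>w = u P\<close>. As \<open>p\<^sub>i\<^sub>j\<close> depends only on
  \<open>x\<^sub>j - x\<^sub>i\<close>, every \<open>\<eta>\<^sub>a\<close> with \<open>a \<noteq> 0\<close> is an eigenvector of \<open>P\<close>; its eigenvalue is the Gauss sum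
  \<open>g\<close> if \<open>a\<close> is a square and \<open>- g\<close> otherwise. Hence the entries of \<open>w - g u\<close> are the
  coefficients of a vanishing combination of the \<open>\<mu>\<close>'s, and those of \<open>w + g u\<close> of one of the
  \<open>\<nu>\<close>'s. Both vectors have their supports in the union of those of
  \<open>u\<close> and \<open>w\<close>, so if \<open>c\<close> had weight at most \<open>A\<close>, both would be zero, and
  \<open>2 g u = 0\<close> would force \<open>u = 0\<close>, since \<open>g \<noteq> 0\<close> and \<open>p\<close> is odd.\<close>

no_notation fps_nth (infixl "$" 75)

section \<open>Primitive elements and the quadratic character\<close>

lemma primitive_element_nonzero:
  fixes a :: "'a::field"
  assumes "primitive_element F a"
  shows "a \<noteq> 0"
proof -
  have "a ^ 1 \<in> {a ^ k |k. True}" by blast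
  hence "a ^ 1 \<in> F - {0}" using assms unfolding primitive_element_def by blast
  thus ?thesis by simp
qed

text \<open>The powers of \<open>a\<close> have as period the least positive \<open>d\<close> with
  \<open>a ^ d = 1\<close> and are distinct below \<open>d\<close>, so \<open>F - {0}\<close> has
  exactly \<open>d\<close> elements. \<open>F\<close> is a set because the lemma serves both the
  whole type \<open>'f\<close> and the subfield \<open>K\<close> of the closure.\<close>

lemma primitive_element_power_eq_1_iff:
  fixes a :: "'a::field"
  assumes prim: "primitive_element F a" and "finite F" and "0 \<in> F"
  shows "a ^ k = 1 \<longleftrightarrow> (card F - 1) dvd k"
proof -
  have a0: "a \<noteq> 0" using primitive_element_nonzero[OF prim] .
  have pow: "range (\<lambda>k. a ^ k) = F - {0}"
    using prim unfolding primitive_element_def full_SetCompr_eq[symmetric] by metis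
  have "finite (range (\<lambda>k. a ^ k))" using pow assms(2) by simp
  then obtain i j :: nat where ij: "i < j" "a ^ i = a ^ j"
    using finite_imageD infinite_UNIV_nat unfolding inj_on_def
    by (metis linorder_neqE_nat)
  have "a ^ i * a ^ (j - i) = a ^ i * 1"
    unfolding power_add[symmetric] using ij by simp
  hence "a ^ (j - i) = 1" using a0 by simp
  hence ex: "\<exists>d. d > 0 \<and> a ^ d = 1" using ij(1) by (metis zero_less_diff)
  define d where "d = (LEAST d. d > 0 \<and> a ^ d = 1)"
  have d: "d > 0" "a ^ d = 1" using LeastI_ex[OF ex] unfolding d_def by auto
  have least: "d \<le> k" if "k > 0" "a ^ k = 1" for k
    using that unfolding d_def by (intro Least_le) auto
  have amod: "a ^ (k mod d) = a ^ k" for k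
  proof -
    have "a ^ k = a ^ (d * (k div d) + k mod d)" by simp
    also have "\<dots> = a ^ (k mod d)" by (simp only: power_add power_mult d) simp
    finally show ?thesis by simp
  qed
  have "range (\<lambda>k. a ^ k) = (\<lambda>k. a ^ k) ` {..<d}"
  proof (intro subset_antisym subsetI)
    fix y assume "y \<in> range (\<lambda>k. a ^ k)"
    then obtain k where "y = a ^ (k mod d)" using amod by auto
    thus "y \<in> (\<lambda>k. a ^ k) ` {..<d}" using d(1) by auto
  qed auto
  moreover have "inj_on (\<lambda>k. a ^ k) {..<d}"
  proof (rule linorder_inj_onI)
    fix i j assume *: "i < j" "i \<in> {..<d}" "j \<in> {..<d}"
    show "a ^ i \<noteq> a ^ j"
    proof
      assume "a ^ i = a ^ j"
      hence "a ^ i * a ^ (j - i) = a ^ i * 1"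
        unfolding power_add[symmetric] using * by simp
      hence "a ^ (j - i) = 1" using a0 by simp
      hence "d \<le> j - i" using * by (intro least) auto
      thus False using * by auto
    qed
  qed auto
  ultimately have "card (F - {0}) = d" using pow by (metis card_image card_lessThan)
  hence "card F - 1 = d" using assms(2,3) by simp
  moreover have "a ^ k = 1 \<longleftrightarrow> d dvd k"
  proof
    assume "a ^ k = 1"
    hence "a ^ (k mod d) = 1" by (simp add: amod)
    hence "\<not> k mod d > 0" using least[of "k mod d"] mod_less_divisor[OF d(1), of k] by linarith
    thus "d dvd k" by (simp add: dvd_eq_mod_eq_0)
  next
    assume "d dvd k"
    thus "a ^ k = 1" using d(2) by (auto simp: power_mult)
  qed
  ultimately show ?thesis by simp
qed

lemma primitive_element_power_eq_iff:
  fixes a :: "'a::field"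
  assumes prim: "primitive_element F a" and "finite F" and "0 \<in> F"
  shows "a ^ i = a ^ j \<longleftrightarrow> i mod (card F - 1) = j mod (card F - 1)"
proof (induction i j rule: linorder_wlog)
  case (le i j)
  have "a ^ i = a ^ j \<longleftrightarrow> a ^ i * 1 = a ^ i * a ^ (j - i)"
    unfolding power_add[symmetric] using le by simp
  also have "\<dots> \<longleftrightarrow> a ^ (j - i) = 1"
    using primitive_element_nonzero[OF prim] by auto
  also have "\<dots> \<longleftrightarrow> i mod (card F - 1) = j mod (card F - 1)"
    unfolding primitive_element_power_eq_1_iff[OF assms]
    using mod_eq_dvd_iff_nat[OF le, of "card F - 1"] by auto
  finally show ?case .
qed auto

text \<open>This makes \<zeta> a primitive \<open>r\<close>-th root of unity. With
  \<open>card K - 1 = r * s\<close> the condition becomes \<open>r * s dvd s * k\<close>, and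
  \<open>s\<close> cancels.\<close>

lemma primitive_element_root_of_unity:
  fixes \<gamma> :: "'k::field"
  assumes "primitive_element K \<gamma>" "finite K" "0 \<in> K" and "card K > 1"
    and "r dvd card K - 1"
  shows "(\<gamma> ^ ((card K - 1) div r)) ^ k = 1 \<longleftrightarrow> r dvd k"
proof -
  obtain s where s: "card K - 1 = r * s" using assms(5) by blast
  hence pos: "r > 0" "s > 0" using assms(4) by (auto intro: gr0I)
  have "(\<gamma> ^ ((card K - 1) div r)) ^ k = 1 \<longleftrightarrow> r * s dvd s * k"
    using primitive_element_power_eq_1_iff[OF assms(1-3), of "s * k"] s pos
    by (simp add: power_mult)
  also have "\<dots> \<longleftrightarrow> r dvd k" using pos by (simp add: mult.commute[of r])
  finally show ?thesis .
qed

lemma primitive_element_exponent: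
  assumes "primitive_element UNIV (a :: 'a::field)" and "y \<noteq> 0"
  obtains k where "y = a ^ k"
  using assms unfolding primitive_element_def by blast

context
  fixes \<alpha> :: "'f::finite_field"
  assumes prim: "primitive_element UNIV \<alpha>" and odd_card: "odd CARD('f)"
begin

text \<open>The exponent selected by \<open>THE\<close> is \<open>k mod (CARD('f) - 1)\<close>. The
  modulus is even, so the reduction preserves the parity of \<open>k\<close>.\<close>

lemma phi_power: "phi \<alpha> (\<alpha> ^ k) = ((-1) ^ k :: 'q::finite_field)"
proof -
  let ?d = "CARD('f) - 1"
  have eq_iff: "\<alpha> ^ i = \<alpha> ^ j \<longleftrightarrow> i mod ?d = j mod ?d" for i j
    using primitive_element_power_eq_iff[OF prim] by simp
  have "CARD('f) \<ge> 2"
    using card_mono[of UNIV "{0, 1 :: 'f}"] by simp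
  hence d: "?d > 0" and ev: "even ?d" and le: "i \<le> CARD('f) - 2 \<longleftrightarrow> i < ?d" for i
    using odd_card by auto
  have "(THE i. i \<le> CARD('f) - 2 \<and> \<alpha> ^ i = \<alpha> ^ k) = k mod ?d"
    by (rule the_equality) (use d in \<open>auto simp: le eq_iff\<close>)
  moreover have "even (k mod ?d) \<longleftrightarrow> even k"
    using ev by (simp add: dvd_mod_iff)
  ultimately show ?thesis unfolding phi_def
    by (metis neg_one_even_power neg_one_odd_power)
qed

lemma phi_mult:
  assumes "y \<noteq> 0" "z \<noteq> 0"
  shows "phi \<alpha> (y * z) = (phi \<alpha> y * phi \<alpha> z :: 'q::finite_field)"
proof -
  obtain i j where "y = \<alpha> ^ i" "z = \<alpha> ^ j"
    using assms primitive_element_exponent[OF prim] by metis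
  thus ?thesis by (simp add: phi_power flip: power_add)
qed

lemma phi_square:
  assumes "y \<noteq> 0"
  shows "phi \<alpha> (y ^ 2) = (1 :: 'q::finite_field)"
proof -
  obtain i where "y = \<alpha> ^ i"
    using assms primitive_element_exponent[OF prim] by metis
  hence "y ^ 2 = \<alpha> ^ (i * 2)" by (simp add: power_mult)
  thus ?thesis by (simp add: phi_power)
qed

lemma phi_nonsquare:
  assumes "\<nexists>z. y = z ^ 2"
  shows "phi \<alpha> y = (-1 :: 'q::finite_field)"
proof -
  have "y \<noteq> 0" using assms by (metis power_zero_numeral)
  then obtain i where i: "y = \<alpha> ^ i"
    using primitive_element_exponent[OF prim] by metis
  have "odd i"
  proof
    assume "even i"
    then obtain j where "i = j * 2" by (metis dvd_def mult.commute)
    hence "y = (\<alpha> ^ j) ^ 2" using i by (simp add: power_mult)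
    thus False using assms by blast
  qed
  thus ?thesis using i by (simp add: phi_power)
qed

text \<open>Otherwise 1 and an even exponent would agree modulo the even number
  \<open>CARD('f) - 1\<close>. This supplies an element at which the quadratic character is
  -1.\<close>

lemma nonsquare_primitive_element: "\<nexists>z. \<alpha> = z ^ 2"
proof
  assume "\<exists>z. \<alpha> = z ^ 2"
  then obtain z where z: "\<alpha> = z ^ 2" by blast
  have "z \<noteq> 0" using primitive_element_nonzero[OF prim] z by auto
  then obtain i where "z = \<alpha> ^ i"
    using primitive_element_exponent[OF prim] by metis
  hence "\<alpha> ^ 1 = \<alpha> ^ (i * 2)" using z by (simp add: power_mult)
  hence "1 mod (CARD('f) - 1) = (i * 2) mod (CARD('f) - 1)"
    using primitive_element_power_eq_iff[OF prim, of 1 "i * 2"] by (simp only: finite UNIV_I)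
  moreover have "even (CARD('f) - 1)" using odd_card by simp
  ultimately have "even (1::nat) \<longleftrightarrow> even (i * 2)" by (metis dvd_mod_iff)
  thus False by simp
qed

end

section \<open>The absolute trace\<close>

lemma CHAR_eq_of_CARD_prime_power:
  assumes "prime r" and "CARD('f::finite_field) = r ^ m"
  shows "CHAR('f) = r"
proof -
  have "CHAR('f) dvd r ^ m" using CHAR_dvd_CARD[where 'a='f] assms(2) by simp
  hence "CHAR('f) dvd r" using CHAR_prime[where 'a='f] prime_dvd_power by blast
  thus ?thesis using CHAR_prime[where 'a='f] assms(1) primes_dvd_imp_eq by blast
qed

context
  fixes r m :: nat
  assumes r: "prime r" and m: "m > 0" and card_f: "CARD('f::finite_field) = r ^ m"
begin

lemma field_trace_add:
  "field_trace r m (y + z) = field_trace r m y + (field_trace r m z :: 'f)"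
  using CHAR_eq_of_CARD_prime_power[OF r card_f] r
  by (simp add: field_trace_def freshmans_dream' sum.distrib)

text \<open>The Frobenius map permutes the summands of the trace cyclically, because
  \<open>y ^ (r ^ m) = y\<close>.\<close>

lemma field_trace_power: "field_trace r m (y :: 'f) ^ r = field_trace r m y"
proof -
  have "field_trace r m y ^ r = (\<Sum>i<m. y ^ (r ^ Suc i))"
    using CHAR_eq_of_CARD_prime_power[OF r card_f] r
    by (simp add: field_trace_def freshmans_dream_sum flip: power_mult)
       (simp add: mult.commute)
  \<comment> \<open>The missing first summand is added, so the chain continues from
    \<open>field_trace r m y ^ r + y ^ (r ^ 0)\<close>; it cancels against
    \<open>y ^ (r ^ m)\<close> at the end.\<close>
  also have "\<dots> + y ^ (r ^ 0) = (\<Sum>i<Suc m. y ^ (r ^ i))"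
    by (subst sum.lessThan_Suc_shift) simp
  also have "\<dots> = field_trace r m y + y ^ (r ^ m)"
    by (simp add: field_trace_def)
  also have "y ^ (r ^ m) = y"
    using finite_field_power_card_eq_same[of y] card_f by simp
  finally show ?thesis by simp
qed

text \<open>The polynomial \<open>X^r - X\<close> has at most \<open>r\<close> roots, and the images
  of \<open>0, ..., r - 1\<close> already are \<open>r\<close> distinct ones; the trace is a root,
  hence one of them. So the \<open>THE\<close> in \<open>trace_nat\<close> is well defined.\<close>

lemma field_trace_in_prime_field: "\<exists>!k. k < r \<and> of_nat k = field_trace r m (y :: 'f)"
proof -
  have ch: "CHAR('f) = r" using CHAR_eq_of_CARD_prime_power[OF r card_f] .
  have r1: "r > 1" using r by (rule prime_gt_1_nat)
  let ?R = "{z :: 'f. z ^ r = z}"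
  define P :: "'f poly" where "P = monom 1 r - monom 1 1"
  have "coeff P r = 1" using r1 by (simp add: P_def)
  hence P0: "P \<noteq> 0" by auto
  have "Polynomial.degree P \<le> r"
    unfolding P_def using r1 by (intro degree_diff_le) (auto simp: degree_monom_eq)
  moreover have "{z. poly P z = 0} = ?R"
    by (auto simp: P_def poly_monom)
  ultimately have "card ?R \<le> r"
    using card_poly_roots_bound[OF P0] by simp
  moreover have inj: "inj_on (of_nat :: nat \<Rightarrow> 'f) {..<r}"
    by (auto simp: inj_on_def of_nat_eq_iff_cong_CHAR ch cong_def)
  \<comment> \<open>Fermat's little theorem, by induction on \<open>k\<close> with additivity of the
    Frobenius map.\<close>
  have "of_nat k ^ r = (of_nat k :: 'f)" for k
  proof (induction k)
    case (Suc k)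
    have "(1 + of_nat k :: 'f) ^ r = 1 ^ r + of_nat k ^ r"
      by (rule freshmans_dream) (use ch r in auto)
    thus ?case using Suc by simp
  qed (use r1 in auto)
  hence "of_nat ` {..<r} \<subseteq> ?R" by auto
  ultimately have "of_nat ` {..<r} = ?R"
    using inj by (intro card_seteq) (auto simp: card_image)
  hence "field_trace r m y \<in> of_nat ` {..<r}"
    using field_trace_power by auto
  thus ?thesis using inj by (auto simp: inj_on_def)
qed

lemma of_nat_trace_nat: "of_nat (trace_nat r m y) = field_trace r m (y :: 'f)"
  and trace_nat_less: "trace_nat r m (y :: 'f) < r"
  using theI'[OF field_trace_in_prime_field[of y]] unfolding trace_nat_def by auto

lemma trace_nat_add:
  "[trace_nat r m (y + z :: 'f) = trace_nat r m y + trace_nat r m z] (mod r)"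
  using CHAR_eq_of_CARD_prime_power[OF r card_f] field_trace_add[of y z]
  by (metis of_nat_add of_nat_eq_iff_cong_CHAR of_nat_trace_nat)

text \<open>The trace is given by a polynomial of degree at most \<open>r ^ (m - 1)\<close> whose
  linear coefficient is 1, so it has fewer than \<open>r ^ m\<close> roots.\<close>

lemma field_trace_nontrivial: "\<exists>y :: 'f. field_trace r m y \<noteq> 0"
proof (rule ccontr)
  assume "\<not> ?thesis"
  hence zero: "field_trace r m y = 0" for y :: 'f by blast
  have r1: "r > 1" using r by (rule prime_gt_1_nat)
  define P :: "'f poly" where "P = (\<Sum>i<m. monom 1 (r ^ i))"
  have "coeff P 1 = (\<Sum>i<m. if i = 0 then 1 else 0)"
    unfolding P_def coeff_sum using r1 by (intro sum.cong) auto
  also have "\<dots> = 1" using m by simp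
  finally have P0: "P \<noteq> 0" by auto
  have "Polynomial.degree P \<le> r ^ (m - 1)"
    unfolding P_def using r1 m
    by (intro degree_sum_le) (auto simp: degree_monom_eq intro!: power_increasing)
  moreover have "{y. poly P y = 0} = UNIV"
    using zero by (simp add: P_def poly_sum poly_monom field_trace_def)
  ultimately have "r ^ m \<le> r ^ (m - 1)"
    using card_poly_roots_bound[OF P0] card_f by simp
  moreover have "r ^ (m - 1) < r ^ m" using r1 m by (intro power_strict_increasing) auto
  ultimately show False by simp
qed

end

section \<open>The additive character defined by the trace\<close>

context
  fixes r m :: nat and \<zeta> :: "'k::field"
  assumes r: "prime r" and m: "m > 0" and card_f: "CARD('f::finite_field) = r ^ m"
    and \<zeta>: "\<And>k. \<zeta> ^ k = 1 \<longleftrightarrow> r dvd k"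
begin

lemma trace_character_add:
  "\<zeta> ^ trace_nat r m (y + z :: 'f) = \<zeta> ^ trace_nat r m y * \<zeta> ^ trace_nat r m z"
proof -
  have mod: "\<zeta> ^ (k mod r) = \<zeta> ^ k" for k
  proof -
    have "\<zeta> ^ k = \<zeta> ^ (r * (k div r) + k mod r)" by simp
    also have "\<dots> = (\<zeta> ^ r) ^ (k div r) * \<zeta> ^ (k mod r)"
      by (simp only: power_add power_mult)
    finally show ?thesis using \<zeta>[of r] by simp
  qed
  have "\<zeta> ^ (trace_nat r m (y + z) mod r) = \<zeta> ^ ((trace_nat r m y + trace_nat r m z) mod r)"
    using trace_nat_add[OF r m card_f, of y z] by (simp add: cong_def)
  thus ?thesis by (simp add: mod power_add)
qed

lemma trace_character_0: "\<zeta> ^ trace_nat r m (0 :: 'f) = 1"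
proof -
  have "\<zeta> \<noteq> 0" using \<zeta>[of r] r by (metis dvd_refl power_0_left prime_gt_0_nat
      not_gr_zero zero_neq_one)
  thus ?thesis using trace_character_add[of 0 0] by simp
qed

lemma trace_character_nontrivial: "\<exists>y :: 'f. \<zeta> ^ trace_nat r m y \<noteq> 1"
proof -
  obtain y :: 'f where "field_trace r m y \<noteq> 0"
    using field_trace_nontrivial[OF r m card_f] by blast
  hence "trace_nat r m y \<noteq> 0" using of_nat_trace_nat[OF r m card_f, of y] by (metis of_nat_0)
  hence "\<not> r dvd trace_nat r m y"
    using trace_nat_less[OF r m card_f, of y] nat_dvd_not_less by blast
  thus ?thesis using \<zeta> by blast
qed

end

section \<open>Gauss sums of a quadratic character\<close>

lemma sum_UNIV_mult:
  fixes a :: "'f::finite_field"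
  assumes "a \<noteq> 0"
  shows "(\<Sum>y\<in>UNIV. g (a * y)) = (\<Sum>y\<in>UNIV. g y)"
  by (rule sum.reindex_bij_witness[of _ "\<lambda>y. y / a" "\<lambda>y. a * y"]) (use assms in auto)

lemma sum_UNIV_add:
  fixes c :: "'f::finite_field"
  shows "(\<Sum>y\<in>UNIV. g (y + c)) = (\<Sum>y\<in>UNIV. g y)"
  by (rule sum.reindex_bij_witness[of _ "\<lambda>y. y - c" "\<lambda>y. y + c"]) auto

lemma eq_minus_self_imp_zero:
  fixes s :: "'k::field"
  assumes "s = - s" and "(2 :: 'k) \<noteq> 0"
  shows "s = 0"
proof -
  have "s + s = 0" by (subst (2) assms(1)) simp
  hence "2 * s = 0" by (simp only: mult_2)
  thus ?thesis using assms(2) by simp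
qed

context
  fixes \<psi> \<chi> :: "'f::finite_field \<Rightarrow> 'k::field"
  assumes psi_add: "\<psi> (y + z) = \<psi> y * \<psi> z" and psi_0: "\<psi> 0 = 1"
    and psi_nontrivial: "\<exists>z. \<psi> z \<noteq> 1"
    and chi_mult: "\<chi> (y * z) = \<chi> y * \<chi> z" and chi_0: "\<chi> 0 = 0"
    and chi_sq: "y \<noteq> 0 \<Longrightarrow> \<chi> y * \<chi> y = 1"
    and chi_nontrivial: "\<exists>y. \<chi> y = -1"
    and two: "(2 :: 'k) \<noteq> 0" and card: "of_nat CARD('f) \<noteq> (0 :: 'k)"
begin

definition gauss_sum :: 'k where
  "gauss_sum = (\<Sum>y\<in>UNIV. \<chi> y * \<psi> y)"

text \<open>Orthogonality: for \<open>b \<noteq> 0\<close>, translating \<open>a\<close> by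
  \<open>z / b\<close> multiplies the sum by \<open>\<psi> z\<close>, which can be chosen different
  from 1.\<close>

lemma sum_additive_character:
  "(\<Sum>a\<in>UNIV. \<psi> (a * b)) = (if b = 0 then of_nat CARD('f) else 0)"
proof (cases "b = 0")
  case False
  obtain z where z: "\<psi> z \<noteq> 1" using psi_nontrivial by blast
  have "(\<Sum>a\<in>UNIV. \<psi> (a * b)) = (\<Sum>a\<in>UNIV. \<psi> ((a + z / b) * b))"
    by (rule sum_UNIV_add[symmetric])
  also have "\<dots> = (\<Sum>a\<in>UNIV. \<psi> (a * b)) * \<psi> z"
    unfolding sum_distrib_right using False
    by (intro sum.cong) (simp_all add: distrib_right psi_add)
  finally show ?thesis using z False by simp
qed (simp add: psi_0)

text \<open>Substitute \<open>a * y\<close> for \<open>y\<close> in the Gauss sum; the factor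
  \<open>\<chi> a\<close> is its own inverse.\<close>

lemma gauss_sum_twist:
  assumes "a \<noteq> 0"
  shows "(\<Sum>y\<in>UNIV. \<chi> y * \<psi> (a * y)) = \<chi> a * gauss_sum"
proof -
  have "\<chi> a * gauss_sum = \<chi> a * (\<Sum>y\<in>UNIV. \<chi> (a * y) * \<psi> (a * y))"
    unfolding gauss_sum_def using sum_UNIV_mult[OF assms, of "\<lambda>y. \<chi> y * \<psi> y"] by simp
  also have "\<dots> = (\<Sum>y\<in>UNIV. (\<chi> a * \<chi> a) * (\<chi> y * \<psi> (a * y)))"
    by (simp add: sum_distrib_left chi_mult mult_ac)
  finally show ?thesis by (simp add: chi_sq[OF assms])
qed

text \<open>Scaling the variable by an \<open>a\<close> with \<open>\<chi> a = -1\<close> negates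
  the sum.\<close>

lemma sum_quadratic_character: "(\<Sum>y\<in>UNIV. \<chi> y) = 0"
proof -
  obtain a where a: "\<chi> a = -1" using chi_nontrivial by blast
  hence "a \<noteq> 0" using chi_0 by auto
  hence "(\<Sum>y\<in>UNIV. \<chi> y) = (\<Sum>y\<in>UNIV. \<chi> (a * y))" by (rule sum_UNIV_mult[symmetric])
  also have "\<dots> = - (\<Sum>y\<in>UNIV. \<chi> y)" by (simp add: chi_mult a sum_negf)
  finally show ?thesis by (rule eq_minus_self_imp_zero[OF _ two])
qed

text \<open>If the Gauss sum vanished, so would the Fourier transform of \<open>\<chi>\<close>; but Fourier inversion
  recovers \<open>CARD('f) * \<chi> 1\<close> from it.\<close>

lemma gauss_sum_nonzero: "gauss_sum \<noteq> 0"
proof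
  assume G: "gauss_sum = 0"
  have chi_1: "\<chi> 1 = 1" using chi_mult[of 1 1] chi_sq[of 1] by simp
  \<comment> \<open>At \<open>a = 0\<close> the transform is the plain sum of \<chi>, which
    \<open>gauss_sum_twist\<close> does not cover.\<close>
  have zero: "(\<Sum>y\<in>UNIV. \<chi> y * \<psi> (a * y)) = 0" for a
    by (cases "a = 0") (simp_all add: gauss_sum_twist G psi_0 sum_quadratic_character)
  have "0 = (\<Sum>a\<in>UNIV. \<psi> (- a) * (\<Sum>y\<in>UNIV. \<chi> y * \<psi> (a * y)))"
    by (simp add: zero)
  also have "\<dots> = (\<Sum>a\<in>UNIV. \<Sum>y\<in>UNIV. \<chi> y * \<psi> (a * (y - 1)))"
    unfolding sum_distrib_left
  proof (intro sum.cong refl)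
    fix a y :: 'f
    have "a * (y - 1) = - a + a * y" by (simp add: algebra_simps)
    hence "\<psi> (a * (y - 1)) = \<psi> (- a) * \<psi> (a * y)" by (simp only: psi_add)
    thus "\<psi> (- a) * (\<chi> y * \<psi> (a * y)) = \<chi> y * \<psi> (a * (y - 1))" by simp
  qed
  also have "\<dots> = (\<Sum>y\<in>UNIV. \<chi> y * (\<Sum>a\<in>UNIV. \<psi> (a * (y - 1))))"
    unfolding sum_distrib_left by (rule sum.swap)
  also have "\<dots> = (\<Sum>y\<in>UNIV. if y = (1 :: 'f) then of_nat CARD('f) else (0 :: 'k))"
    by (intro sum.cong) (simp_all add: sum_additive_character chi_1)
  also have "\<dots> = of_nat CARD('f)" by simp
  finally show False using card by simp
qed

text \<open>The characters \<open>y \<mapsto> \<psi> (a * y)\<close> are eigenvectors of the matrix \<open>P\<close>, with eigenvalue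
  \<open>\<chi> a * gauss_sum\<close>.\<close>

lemma sum_convolution_character:
  assumes "a \<noteq> 0"
  shows "(\<Sum>y\<in>UNIV. (\<Sum>z\<in>UNIV. u z * \<chi> (y - z)) * \<psi> (a * y)) =
    \<chi> a * gauss_sum * (\<Sum>z\<in>UNIV. u z * \<psi> (a * z))"
proof -
  have "(\<Sum>y\<in>UNIV. (\<Sum>z\<in>UNIV. u z * \<chi> (y - z)) * \<psi> (a * y)) =
      (\<Sum>z\<in>UNIV. \<Sum>y\<in>UNIV. u z * \<chi> (y - z) * \<psi> (a * y))"
    unfolding sum_distrib_right by (rule sum.swap)
  also have "\<dots> = (\<Sum>z\<in>UNIV. \<chi> a * gauss_sum * (u z * \<psi> (a * z)))"
  proof (intro sum.cong refl)
    fix z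
    \<comment> \<open>Translating \<open>y\<close> by \<open>z\<close> removes \<open>z\<close> from
      \<chi> and splits off the factor \<open>\<psi> (a * z)\<close>.\<close>
    have "(\<Sum>y\<in>UNIV. u z * \<chi> (y - z) * \<psi> (a * y)) =
        (\<Sum>y\<in>UNIV. u z * \<chi> (y + z - z) * \<psi> (a * (y + z)))"
      by (rule sum_UNIV_add[symmetric])
    also have "\<dots> = u z * \<psi> (a * z) * (\<Sum>y\<in>UNIV. \<chi> y * \<psi> (a * y))"
      by (simp add: distrib_left psi_add sum_distrib_left mult_ac)
    finally show "(\<Sum>y\<in>UNIV. u z * \<chi> (y - z) * \<psi> (a * y)) =
        \<chi> a * gauss_sum * (u z * \<psi> (a * z))"
      unfolding gauss_sum_twist[OF assms] by (simp only: mult_ac)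
  qed
  finally show ?thesis by (simp add: sum_distrib_left)
qed

text \<open>Here \<open>w\<close> is \<open>u P\<close>, read as a function on the field. The
  premise \<open>indpt\<close> treats both independence assumptions at once: \<open>s = 1\<close>
  stands for the \<mu>'s and \<open>s = -1\<close> for the \<nu>'s. Applied to
  \<open>w - s * gauss_sum * u\<close>, it yields \<open>w = gauss_sum * u\<close> and
  \<open>w = - gauss_sum * u\<close> together.\<close>

lemma convolution_support_bound:
  fixes u :: "'f \<Rightarrow> 'k"
  defines "w \<equiv> \<lambda>y. \<Sum>z\<in>UNIV. u z * \<chi> (y - z)"
  assumes indpt: "\<And>s h. s \<in> {1, -1} \<Longrightarrow> (\<And>a. \<chi> a = s \<Longrightarrow> (\<Sum>y\<in>UNIV. h y * \<psi> (a * y)) = 0) \<Longrightarrow>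
      card {y. h y \<noteq> 0} \<le> A \<Longrightarrow> h = (\<lambda>_. 0)"
    and "u \<noteq> (\<lambda>_. 0)"
  shows "A < card {y. u y \<noteq> 0} + card {y. w y \<noteq> 0}"
proof (rule ccontr)
  assume "\<not> ?thesis"
  hence le: "card {y. u y \<noteq> 0} + card {y. w y \<noteq> 0} \<le> A" by simp
  have eq: "w y = s * gauss_sum * u y" if s: "s \<in> {1, -1}" for s y
  proof -
    define h where "h = (\<lambda>y. w y - s * gauss_sum * u y)"
    have "(\<Sum>y\<in>UNIV. h y * \<psi> (a * y)) = 0" if "\<chi> a = s" for a
    proof -
      have "a \<noteq> 0" using that s chi_0 by auto
      hence "(\<Sum>y\<in>UNIV. w y * \<psi> (a * y)) = s * gauss_sum * (\<Sum>y\<in>UNIV. u y * \<psi> (a * y))"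
        using sum_convolution_character[of a u] that by (simp add: w_def)
      thus ?thesis
        by (simp add: h_def left_diff_distrib sum_subtractf sum_distrib_left mult.assoc)
    qed
    moreover have "card {y. h y \<noteq> 0} \<le> A"
    proof -
      have "card {y. h y \<noteq> 0} \<le> card ({y. u y \<noteq> 0} \<union> {y. w y \<noteq> 0})"
        by (rule card_mono) (auto simp: h_def)
      thus ?thesis using card_Un_le[of "{y. u y \<noteq> 0}" "{y. w y \<noteq> 0}"] le by linarith
    qed
    ultimately have "h = (\<lambda>_. 0)" by (rule indpt[OF s])
    from fun_cong[OF this, of y] show ?thesis by (simp add: h_def)
  qed
  have "u y = 0" for y
  proof -
    have "gauss_sum * u y = - (gauss_sum * u y)" using eq[of 1 y] eq[of "-1" y] by simp
    hence "gauss_sum * u y = 0" by (rule eq_minus_self_imp_zero[OF _ two])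
    thus ?thesis using gauss_sum_nonzero by simp
  qed
  thus False using assms(3) by auto
qed

end

section \<open>Independence of rows and the code in coordinates\<close>

text \<open>Independence is given for exactly \<open>A\<close> indices, so the support of
  \<open>c\<close> is first enlarged to a set \<open>S\<close> of that size, which exists because
  \<open>A \<le> n\<close>.\<close>

lemma any_indpt_imp_coefficients_zero:
  fixes v :: "nat \<Rightarrow> 'k::field vec"
  assumes indpt: "any_indpt d n A v" and "A \<le> n"
    and v: "\<And>i. i \<in> {1..n} \<Longrightarrow> v i \<in> carrier_vec d"
    and sum0: "\<And>j. j < d \<Longrightarrow> (\<Sum>i\<in>{1..n}. c i * v i $ j) = 0"
    and card: "card {i\<in>{1..n}. c i \<noteq> 0} \<le> A"
    and i: "i \<in> {1..n}"
  shows "c i = 0"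
proof (rule ccontr)
  assume ci: "c i \<noteq> 0"
  interpret vec_space "TYPE('k)" d .
  obtain S where S: "{i\<in>{1..n}. c i \<noteq> 0} \<subseteq> S" "S \<subseteq> {1..n}" "card S = A"
    using exists_subset_between[of "{i\<in>{1..n}. c i \<noteq> 0}" A "{1..n}"] card \<open>A \<le> n\<close>
    by (metis (no_types, lifting) card_atLeastAtMost diff_Suc_1 finite_atLeastAtMost mem_Collect_eq subsetI)
  have finS: "finite S" using S(2) finite_subset by blast
  from S indpt have inj: "inj_on v S" and li: "lin_indpt (v ` S)"
    unfolding any_indpt_def by auto
  have vS: "v ` S \<subseteq> carrier_vec d" using v S(2) by auto
  \<comment> \<open>Coefficients in \<open>lincomb\<close> are attached to vectors, not indices;
    injectivity of \<open>v\<close> on \<open>S\<close> makes the transfer possible.\<close>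
  define a where "a = c \<circ> inv_into S v"
  have a: "a (v k) = c k" if "k \<in> S" for k
    using that inj by (simp add: a_def)
  have "lincomb a (v ` S) = 0\<^sub>v d"
  proof (rule eq_vecI)
    fix j assume "j < dim_vec (0\<^sub>v d :: 'k vec)"
    hence j: "j < d" by simp
    have "lincomb a (v ` S) $ j = (\<Sum>k\<in>S. c k * v k $ j)"
      using lincomb_index[OF j vS] by (simp add: sum.reindex[OF inj] a)
    also have "\<dots> = (\<Sum>k\<in>{1..n}. c k * v k $ j)"
      using S by (intro sum.mono_neutral_left) auto
    finally show "lincomb a (v ` S) $ j = 0\<^sub>v d $ j" using sum0 j by simp
  qed (use lincomb_dim[OF _ vS] finS in simp)
  moreover have "i \<in> S" using S(1) ci i by auto
  ultimately have "lin_dep (v ` S)"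
    using finS a[of i] ci by (intro lin_dep_crit[where a = a and v = "v i" and A = "v ` S"]) auto
  thus False using li by simp
qed

text \<open>The row space is the image of the transposed generator matrix. Its identity block copies
  the message \<open>y\<close> into the first \<open>n\<close> coordinates; only the values of
  \<open>y\<close> below \<open>n\<close> matter.\<close>

lemma code_eq:
  fixes x :: "nat \<Rightarrow> 'f::finite_field" and \<phi> :: "'f \<Rightarrow> 'q::finite_field"
  shows "code n x \<phi> v = range (\<lambda>y. vec (2 * n)
    (\<lambda>i. if i < n then y i else \<Sum>k<n. y k * P_mat n x \<phi> v $$ (k, i - n)))"
proof -
  interpret vec_space "TYPE('q)" "2 * n" .
  let ?G = "generator_mat n x \<phi> v"
  let ?f = "\<lambda>y :: nat \<Rightarrow> 'q. vec (2 * n)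
    (\<lambda>i. if i < n then y i else \<Sum>k<n. y k * P_mat n x \<phi> v $$ (k, i - n))"
  have P: "P_mat n x \<phi> v \<in> carrier_mat n n" by (simp add: P_mat_def)
  have G: "?G \<in> carrier_mat n (2 * n)"
    using P unfolding generator_mat_def carrier_mat_def by auto
  have *: "?G\<^sup>T *\<^sub>v vec n y = ?f y" for y
  proof (rule eq_vecI)
    fix i assume "i < dim_vec (?f y)"
    hence i: "i < 2 * n" by simp
    have "(?G\<^sup>T *\<^sub>v vec n y) $ i = (\<Sum>k<n. ?G $$ (k, i) * y k)"
      using G i by (auto simp: scalar_prod_def atLeast0LessThan intro!: sum.cong)
    also have "\<dots> = (\<Sum>k<n. y k * (if i < n then if k = i then 1 else 0
        else P_mat n x \<phi> v $$ (k, i - n)))"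
      using P i by (intro sum.cong) (auto simp: generator_mat_def)
    also have "\<dots> = ?f y $ i"
    proof (cases "i < n")
      case True
      hence "(\<Sum>k<n. y k * (if k = i then 1 else 0)) = (\<Sum>k<n. if k = i then y k else 0)"
        by (intro sum.cong) auto
      thus ?thesis using True i by simp
    qed (use i in simp)
    finally show "(?G\<^sup>T *\<^sub>v vec n y) $ i = ?f y $ i" .
  qed (use G in simp)
  show ?thesis
  proof (intro subset_antisym subsetI)
    fix c assume "c \<in> code n x \<phi> v"
    then obtain y where y: "y \<in> carrier_vec n" "c = ?G\<^sup>T *\<^sub>v y"
      using row_space_eq[OF G] G unfolding code_def by auto
    hence "vec n (\<lambda>i. y $ i) = y" by auto
    thus "c \<in> range ?f" using y(2) *[of "\<lambda>i. y $ i"] by auto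
  next
    fix c assume "c \<in> range ?f"
    then obtain y where "c = ?f y" by blast
    hence "c = ?G\<^sup>T *\<^sub>v vec n y" using *[of y] by simp
    thus "c \<in> code n x \<phi> v"
      using row_space_eq[OF G] G unfolding code_def by auto
  qed
qed

text \<open>Two distinct codewords are required so that the set under \<open>Inf\<close> is
  nonempty.\<close>

lemma min_dist_geI:
  assumes "c \<in> C" "c' \<in> C" "c \<noteq> c'"
    and "\<And>c c'. c \<in> C \<Longrightarrow> c' \<in> C \<Longrightarrow> c \<noteq> c' \<Longrightarrow> d \<le> hamming_dist c c'"
  shows "d \<le> min_dist C"
  unfolding min_dist_def
proof (rule cInf_greatest)
  show "{hamming_dist u w |u w. u \<in> C \<and> w \<in> C \<and> u \<noteq> w} \<noteq> {}"
    using assms(1-3) by blast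
next
  fix h assume "h \<in> {hamming_dist u w |u w. u \<in> C \<and> w \<in> C \<and> u \<noteq> w}"
  then obtain u w where "h = hamming_dist u w" "u \<in> C" "w \<in> C" "u \<noteq> w" by auto
  thus "d \<le> h" using assms(4)[of u w] by simp
qed

section \<open>Dimensions and entries of the rows \<mu> and \<nu>\<close>

lemma mu_carrier: "mu r m \<zeta> x i \<in> carrier_vec ((r ^ m - 1) div 2)"
  by (rule carrier_vecI) (simp add: mu_def del: upt_Suc)

lemma diff_half_of_odd:
  assumes "odd (n :: nat)"
  shows "n - (n + 1) div 2 = (n - 1) div 2"
  using assms by presburger

lemma nu_carrier:
  assumes "odd (r ^ m)"
  shows "nu r m \<zeta> x i \<in> carrier_vec ((r ^ m - 1) div 2)"
  by (rule carrier_vecI)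
    (simp only: nu_def index_row mat_of_cols_carrier length_map length_upt diff_half_of_odd[OF assms])

lemma mu_index:
  assumes "i \<in> {1..r ^ m}" "j < (r ^ m - 1) div 2"
  shows "mu r m \<zeta> x i $ j = \<zeta> ^ trace_nat r m (x (Suc j) * x i)"
proof -
  define h where "h = (r ^ m - 1) div 2 + 1"
  have "j < length [1..<h]" using assms(2) by (simp add: h_def)
  \<comment> \<open>Matrix rows are counted from 0: row \<open>i - 1\<close> belongs to
    \<open>x (Suc (i - 1))\<close>, which is \<open>x i\<close> because \<open>i\<close> is at least
    1.\<close>
  moreover have "i - 1 < r ^ m" "Suc (i - 1) = i"
    using assms(1) unfolding atLeastAtMost_iff by linarith+
  ultimately show ?thesis unfolding mu_def h_def[symmetric]
    by (simp add: mat_of_cols_index eta_def chi_def)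
qed

lemma nu_index:
  assumes "odd (r ^ m)" "i \<in> {1..r ^ m}" "j < (r ^ m - 1) div 2"
  shows "nu r m \<zeta> x i $ j = \<zeta> ^ trace_nat r m (x ((r ^ m + 1) div 2 + j) * x i)"
proof -
  define h where "h = (r ^ m + 1) div 2"
  have "j < length [h..<r ^ m]"
    using assms(3) diff_half_of_odd[OF assms(1)] by (simp add: h_def)
  moreover have "i - 1 < r ^ m" "Suc (i - 1) = i"
    using assms(2) unfolding atLeastAtMost_iff by linarith+
  ultimately show ?thesis unfolding nu_def h_def[symmetric]
    by (simp add: mat_of_cols_index eta_def chi_def)
qed

lemma card_Collect_bij_betw:
  assumes "bij_betw x I UNIV"
  shows "card {y. R y} = card {i \<in> I. R (x i)}"
proof -
  have "{y. R y} = x ` {i \<in> I. R (x i)}"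
    using bij_betw_imp_surj_on[OF assms] by force
  moreover have "inj_on x {i \<in> I. R (x i)}"
    using bij_betw_imp_inj_on[OF assms] by (rule inj_on_subset) auto
  ultimately show ?thesis by (simp add: card_image)
qed

text \<open>Carries the independence of rows over to functions on the field: \<open>b j\<close> is
  the element whose character forms column \<open>j\<close>.\<close>

lemma any_indpt_imp_function_zero:
  fixes x :: "nat \<Rightarrow> 'f::finite_field" and \<psi> :: "'f \<Rightarrow> 'k::field" and v :: "nat \<Rightarrow> 'k vec"
  assumes "any_indpt d n A v" and "A \<le> n" and bij: "bij_betw x {1..n} UNIV"
    and "\<And>i. i \<in> {1..n} \<Longrightarrow> v i \<in> carrier_vec d"
    and v: "\<And>i j. i \<in> {1..n} \<Longrightarrow> j < d \<Longrightarrow> v i $ j = \<psi> (b j * x i)"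
    and h: "\<And>j. j < d \<Longrightarrow> (\<Sum>y\<in>UNIV. h y * \<psi> (b j * y)) = 0"
    and card: "card {y. h y \<noteq> 0} \<le> A"
  shows "h = (\<lambda>_. 0)"
proof
  fix y
  obtain i where i: "i \<in> {1..n}" "y = x i"
    using bij_betw_imp_surj_on[OF bij] by blast
  have "(\<Sum>i\<in>{1..n}. h (x i) * v i $ j) = 0" if j: "j < d" for j
  proof -
    have "(\<Sum>i\<in>{1..n}. h (x i) * v i $ j) = (\<Sum>i\<in>{1..n}. h (x i) * \<psi> (b j * x i))"
      by (intro sum.cong) (simp_all add: v[OF _ j])
    also have "\<dots> = (\<Sum>y\<in>UNIV. h y * \<psi> (b j * y))"
      by (rule sum.reindex_bij_betw[OF bij])
    finally show ?thesis using h[OF j] by simp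
  qed
  moreover have "card {i\<in>{1..n}. h (x i) \<noteq> 0} \<le> A"
    using card card_Collect_bij_betw[OF bij, of "\<lambda>y. h y \<noteq> 0"] by simp
  ultimately show "h y = 0"
    unfolding i(2)
    by (intro any_indpt_imp_coefficients_zero[where c = "\<lambda>i. h (x i)", OF assms(1,2,4) _ _ i(1)]) auto
qed

lemma hamming_dist_append:
  "hamming_dist (vec (2 * n) f) (vec (2 * n) g) =
    card {i. i < n \<and> f i \<noteq> g i} + card {i. i < n \<and> f (n + i) \<noteq> g (n + i)}"
proof -
  have "{i. i < dim_vec (vec (2 * n) f) \<and> vec (2 * n) f $ i \<noteq> vec (2 * n) g $ i} =
      {i. i < n \<and> f i \<noteq> g i} \<union> (\<lambda>i. n + i) ` {i. i < n \<and> f (n + i) \<noteq> g (n + i)}"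
    (is "?D = ?L \<union> ?R")
  proof (intro subset_antisym subsetI)
    fix i assume i: "i \<in> ?D"
    show "i \<in> ?L \<union> ?R"
    proof (cases "i < n")
      case False
      hence "i = n + (i - n)" by simp
      thus ?thesis using i by (intro UnI2 image_eqI[of _ _ "i - n"]) auto
    qed (use i in auto)
  qed auto
  moreover have "?L \<inter> ?R = {}" by auto
  ultimately show ?thesis
    unfolding hamming_dist_def by (simp add: card_Un_disjoint card_image)
qed

theorem theorem6p1:
  fixes r m p e q t A :: nat
    and \<alpha> :: "'f::finite_field"
    and x :: "nat \<Rightarrow> 'f"
    and C :: "'q::finite_field vec set"
    and K :: "'q alg_closure set"
    and \<gamma> \<zeta> :: "'q alg_closure"
  assumes "prime r" and "m > 0" and "2 dvd r ^ m - 1"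
    and "prime p" and "odd p" and "e > 0" and "q = p ^ e" and "gcd p r = 1"
    and "CARD('f) = r ^ m" and "CARD('q) = q"
    and "primitive_element UNIV \<alpha>"
    and "square_enumeration (r ^ m) x"
    and "C = code (r ^ m) x (phi \<alpha>) 0"
    and "t > 0" and "r dvd q ^ t - 1"
    and "subfield K ring_of_type_algebra" and "card K = q ^ t"
    and "primitive_element K \<gamma>"
    and "\<zeta> = \<gamma> ^ ((q ^ t - 1) div r)"
    and "A > 0" and "A \<le> r ^ m"
    and "any_indpt ((r ^ m - 1) div 2) (r ^ m) A (mu r m \<zeta> x)"
    and "any_indpt ((r ^ m - 1) div 2) (r ^ m) A (nu r m \<zeta> x)"
  shows "min_dist C \<ge> A + 1"
proof -
  note r = \<open>prime r\<close> and m = \<open>m > 0\<close> and card_f = \<open>CARD('f) = r ^ m\<close>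
    and prim = \<open>primitive_element UNIV \<alpha>\<close>
  define n where "n = r ^ m"
  have "r ^ m > 0" using r prime_gt_0_nat by simp
  hence odd: "odd (r ^ m)"
    using even_diff_nat[of "r ^ m" 1] assms(3) r by (simp del: even_power add: prime_gt_0_nat)
  hence odd_f: "odd CARD('f)" using card_f by simp
  have bij: "bij_betw x {1..n} UNIV"
    and sq: "x ` {1..(n - 1) div 2} = {y. y \<noteq> 0 \<and> (\<exists>z. y = z ^ 2)}"
    and nsq: "x ` {(n + 1) div 2..n - 1} = {y. \<not> (\<exists>z. y = z ^ 2)}"
    using assms(12) unfolding square_enumeration_def n_def by blast+

  \<comment> \<open>The closure has characteristic \<open>p\<close>. Hence 2 is nonzero in it
    because \<open>p\<close> is odd, and \<open>r ^ m\<close> is nonzero because \<open>p\<close>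
    and \<open>r\<close> are coprime.\<close>
  have "CHAR('q) = p" using CHAR_eq_of_CARD_prime_power[OF assms(4)] assms(7,10) by blast
  hence char: "of_nat k = (0 :: 'q alg_closure) \<longleftrightarrow> p dvd k" for k
    by (simp add: of_nat_eq_0_iff_char_dvd)
  have "\<not> p dvd 2" using assms(4,5) primes_dvd_imp_eq two_is_prime_nat by blast
  hence two: "(2 :: 'q alg_closure) \<noteq> 0" using char[of 2] by simp
  have "\<not> p dvd r ^ m"
  proof
    assume "p dvd r ^ m"
    hence "p dvd r" by (rule prime_dvd_power[OF assms(4)])
    hence "p dvd gcd p r" by simp
    thus False using assms(4,8) by simp
  qed
  hence card0: "of_nat CARD('f) \<noteq> (0 :: 'q alg_closure)"
    unfolding char card_f .

  have "p ^ (e * t) > 1"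
    using assms(4,6,14) prime_gt_1_nat one_less_power by (metis nat_0_less_mult_iff)
  hence card_K: "card K > 1" using assms(7,17) by (simp add: power_mult)
  hence finK: "finite K" by (metis card.infinite not_one_less_zero)
  have "0 \<in> K"
    using subringE(2)[OF subfieldE(1)[OF assms(16)]] by (simp add: ring_of_type_algebra_def)
  hence \<zeta>: "\<zeta> ^ k = 1 \<longleftrightarrow> r dvd k" for k
    using primitive_element_root_of_unity[OF assms(18) finK _ card_K, of r k] assms(15,17,19)
    by simp

  define \<psi> :: "'f \<Rightarrow> 'q alg_closure" where "\<psi> = (\<lambda>y. \<zeta> ^ trace_nat r m y)"
  \<comment> \<open>The value 0 at 0 agrees with the diagonal of \<open>P\<close>, so every entry of
    \<open>P\<close> is, inside the closure, \<chi> of a difference.\<close>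
  define \<chi> :: "'f \<Rightarrow> 'q alg_closure" where "\<chi> = (\<lambda>y. to_ac (if y = 0 then 0 else phi \<alpha> y))"
  have psi: "\<psi> (y + z) = \<psi> y * \<psi> z" "\<psi> 0 = 1" "\<exists>y. \<psi> y \<noteq> 1" for y z
    unfolding \<psi>_def by (rule trace_character_add trace_character_0 trace_character_nontrivial,
      rule r, rule m, rule card_f, rule \<zeta>)+
  have chi_mult: "\<chi> (y * z) = \<chi> y * \<chi> z" for y z
    by (simp add: \<chi>_def phi_mult[OF prim odd_f])
  have chi_0: "\<chi> 0 = 0" by (simp add: \<chi>_def)
  have chi_sq: "\<chi> y * \<chi> y = 1" if "y \<noteq> 0" for y
  proof -
    have "\<chi> y * \<chi> y = \<chi> (y ^ 2)" by (simp add: power2_eq_square chi_mult)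
    thus ?thesis using that by (simp add: \<chi>_def phi_square[OF prim odd_f])
  qed
  have chi_nonsquare: "\<chi> y = -1" if y: "\<nexists>z. y = z ^ 2" for y
  proof -
    have "y \<noteq> 0" using y by (metis power_zero_numeral)
    thus ?thesis by (simp add: \<chi>_def phi_nonsquare[OF prim odd_f y])
  qed
  have chi_nontrivial: "\<exists>y. \<chi> y = -1"
    using chi_nonsquare nonsquare_primitive_element[OF prim odd_f] by blast

  \<comment> \<open>Columns of \<mu> belong to squares, where \<chi> is 1, and columns of \<nu> to
    non-squares, where it is -1.\<close>
  have indpt: "h = (\<lambda>_. 0)"
    if s: "s \<in> {1, -1}" and h: "\<And>a. \<chi> a = s \<Longrightarrow> (\<Sum>y\<in>UNIV. h y * \<psi> (a * y)) = 0"
      and card_h: "card {y. h y \<noteq> 0} \<le> A" for s h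
  proof (cases "s = 1")
    case True
    show ?thesis
    proof (rule any_indpt_imp_function_zero[where b = "\<lambda>j. x (Suc j)", OF
          assms(22)[folded n_def] assms(21)[folded n_def] bij _ _ _ card_h])
      fix j assume "j < (n - 1) div 2"
      hence "x (Suc j) \<in> x ` {1..(n - 1) div 2}" by (intro imageI) simp
      then obtain z where "x (Suc j) = z ^ 2" "z \<noteq> 0" unfolding sq by fastforce
      hence "\<chi> (x (Suc j)) = 1" using chi_sq[of z] by (simp add: power2_eq_square chi_mult)
      thus "(\<Sum>y\<in>UNIV. h y * \<psi> (x (Suc j) * y)) = 0" using h True by simp
    qed (simp_all only: mu_carrier mu_index n_def \<psi>_def)
  next
    case False
    show ?thesis
    proof (rule any_indpt_imp_function_zero[where b = "\<lambda>j. x ((n + 1) div 2 + j)", OF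
          assms(23)[folded n_def] assms(21)[folded n_def] bij _ _ _ card_h])
      fix j assume "j < (n - 1) div 2"
      hence "(n + 1) div 2 + j \<in> {(n + 1) div 2..n - 1}" by simp
      hence "x ((n + 1) div 2 + j) \<in> x ` {(n + 1) div 2..n - 1}" by (rule imageI)
      hence "\<chi> (x ((n + 1) div 2 + j)) = -1" unfolding nsq using chi_nonsquare by blast
      thus "(\<Sum>y\<in>UNIV. h y * \<psi> (x ((n + 1) div 2 + j) * y)) = 0" using h False s by simp
    qed (simp_all only: nu_carrier[OF odd] nu_index[OF odd] n_def \<psi>_def)
  qed

  define P :: "'q mat" where "P = P_mat n x (phi \<alpha>) 0"
  define w :: "(nat \<Rightarrow> 'q) \<Rightarrow> nat \<Rightarrow> 'q"
    where "w = (\<lambda>y i. if i < n then y i else \<Sum>k<n. y k * P $$ (k, i - n))"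
  have C: "C = range (\<lambda>y. vec (2 * n) (w y))"
    unfolding assms(13) n_def[symmetric] code_eq w_def P_def ..
  \<comment> \<open>The enumeration shifted to start at 0, to match the coordinates of
    vectors.\<close>
  define pt where "pt = (\<lambda>i. x (Suc i))"
  have "bij_betw Suc {..<n} {1..n}"
    by (rule bij_betw_byWitness[of _ "\<lambda>i. i - 1"]) auto
  hence "bij_betw (x \<circ> Suc) {..<n} UNIV" by (rule bij_betw_trans[OF _ bij])
  hence bij_pt: "bij_betw pt {..<n} UNIV" by (simp only: pt_def comp_def)
  have to_ac_P: "to_ac (P $$ (k, i)) = \<chi> (pt i - pt k)" if "k < n" "i < n" for k i
  proof -
    have "pt i = pt k \<longleftrightarrow> k = i"
      using that bij_betw_imp_inj_on[OF bij_pt] by (auto simp: inj_on_def)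
    thus ?thesis using that by (simp add: P_def P_mat_def \<chi>_def pt_def)
  qed
  have bound: "A + 1 \<le> hamming_dist (vec (2 * n) (w y)) (vec (2 * n) (w y'))"
    if neq: "vec (2 * n) (w y) \<noteq> vec (2 * n) (w y')" for y y'
  proof -
    \<comment> \<open>The difference of two messages, moved from coordinates to field elements and
      embedded in the closure.\<close>
    define u where "u = (\<lambda>z. to_ac (y (inv_into {..<n} pt z) - y' (inv_into {..<n} pt z)))"
    have u: "u (pt k) = to_ac (y k - y' k)" if "k < n" for k
      using that bij_betw_imp_inj_on[OF bij_pt] by (simp add: u_def)
    \<comment> \<open>The second half of the difference of the codewords is the convolution of
      \<open>u\<close> with \<chi>.\<close>
    have conv: "(\<Sum>z\<in>UNIV. u z * \<chi> (pt i - z)) = to_ac (w y (n + i) - w y' (n + i))"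
      if i: "i < n" for i
    proof -
      have "(\<Sum>z\<in>UNIV. u z * \<chi> (pt i - z)) = (\<Sum>k<n. u (pt k) * \<chi> (pt i - pt k))"
        by (rule sum.reindex_bij_betw[OF bij_pt, symmetric])
      also have "\<dots> = (\<Sum>k<n. to_ac ((y k - y' k) * P $$ (k, i)))"
        using i by (intro sum.cong) (simp_all add: u to_ac_P)
      finally show ?thesis
        by (simp add: w_def left_diff_distrib sum_subtractf to_ac_sum)
    qed
    \<comment> \<open>Equal messages would give equal codewords.\<close>
    have u_nonzero: "u \<noteq> (\<lambda>_. 0)"
    proof
      assume "u = (\<lambda>_. 0)"
      hence "y k = y' k" if "k < n" for k using u[OF that] by simp
      hence "w y = w y'" by (auto simp: w_def)
      thus False using neq by simp
    qed
    have "A < card {z. u z \<noteq> 0} + card {z. (\<Sum>z'\<in>UNIV. u z' * \<chi> (z - z')) \<noteq> 0}"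
    proof (rule convolution_support_bound[of \<psi> \<chi>, OF psi chi_mult chi_0 chi_sq chi_nontrivial
          two card0 _ u_nonzero])
      fix s h
      assume "s \<in> {1, -1}" "\<And>a. \<chi> a = s \<Longrightarrow> (\<Sum>y\<in>UNIV. h y * \<psi> (a * y)) = 0"
        "card {y. h y \<noteq> 0} \<le> A"
      thus "h = (\<lambda>_. 0)" by (rule indpt)
    qed
    \<comment> \<open>Both support sizes are turned back into numbers of differing coordinates, one
      for each half of the codewords.\<close>
    also have "card {z. u z \<noteq> 0} = card {k. k < n \<and> w y k \<noteq> w y' k}"
      unfolding card_Collect_bij_betw[OF bij_pt]
      by (rule arg_cong[of _ _ card]) (auto simp: u w_def)
    also have "card {z. (\<Sum>z'\<in>UNIV. u z' * \<chi> (z - z')) \<noteq> 0} =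
        card {i. i < n \<and> w y (n + i) \<noteq> w y' (n + i)}"
      unfolding card_Collect_bij_betw[OF bij_pt]
      by (rule arg_cong[of _ _ card]) (auto simp: conv simp del: to_ac_diff)
    finally show ?thesis unfolding hamming_dist_append by simp
  qed
  show ?thesis
  proof (rule min_dist_geI)
    \<comment> \<open>The codewords of the all-zero and all-one messages serve as two distinct
      elements; they differ at coordinate 0.\<close>
    show "vec (2 * n) (w (\<lambda>_. 0)) \<in> C" "vec (2 * n) (w (\<lambda>_. 1)) \<in> C"
      unfolding C by blast+
    have "n > 0" using \<open>r ^ m > 0\<close> by (simp add: n_def)
    hence "vec (2 * n) (w (\<lambda>_. 0)) $ 0 \<noteq> vec (2 * n) (w (\<lambda>_. 1)) $ 0"
      by (simp add: w_def)
    thus "vec (2 * n) (w (\<lambda>_. 0)) \<noteq> vec (2 * n) (w (\<lambda>_. 1))" by metis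
  qed (use bound in \<open>auto simp: C\<close>)
qed

end
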